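(* Let $Q\in\mathbb{R}^{n\times n}$ be a symmetric positive definite matrix and let $Z\subseteq\{0,1\}^n$. Then $$\operatorname{cl\,conv}(X)=\left\{(x,z,t)\in\mathbb{R}^n\times[0,1]^n\times\mathbb{R}\;:\;\exists\, W\in\mathbb{R}^{n\times n}\text{ such that }\begin{pmatrix}W & x \\ x^\top & t\end{pmatrix}\succeq 0\ \text{ and }\ (z,W)\in P\right\}.$$ Consequently, given vectors $a,b\in\mathbb{R}^n$, the optimization problem $$\min_{x,z,W,t}\left\{a^\top x+b^\top z+\tfrac12 t\;:\;\begin{pmatrix}W & x \\ x^\top & t\end{pmatrix}\succeq 0,\ (z,W)\in P,\ x\in\mathbb{R}^n,\ t\in\mathbb{R}\right\}$$ has an optimal solution integral in $z$.
   Context: $\operatorname{cl\,conv}$ denotes the closure of the convex hull. Let $\mathbf{e}$ be the all-ones vector in $\mathbb{R}^n$ and $\circ$ the Hadamard (entrywise) product. Set $$X=\{(x,z,t)\in\mathbb{R}^n\times Z\times\mathbb{R}: t\ge x^\top Qx,\ x\circ(\mathbf{e}-z)=0\}.$$ For $S\subseteq[n]=\{1,\dots,n\}$, $\hat{\mathbf{e}}_S\in\{0,1\}^n$ is the indicator vector of $S$, $Q_S$ is the principal submatrix of $Q$ indexed by $S$, and $\hat Q_S^{-1}\in\mathbb{R}^{n\times n}$ is the matrix whose submatrix indexed by $S$ equals $Q_S^{-1}$ and whose other entries are all zero (so $\hat Q_\emptyset^{-1}=0$). The polytope $P\subseteq\mathbb{R}^{n+n^2}$ is $$P=\operatorname{conv}\{(\hat{\mathbf{e}}_S,\hat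 Q_S^{-1}): \hat{\mathbf{e}}_S\in Z\}.$$ $M\succeq 0$ means that $M$ is symmetric positive semidefinite. *)

theory Defs
  imports "HOL-Analysis.Analysis"
begin

definition psd :: "real^'m^'m \<Rightarrow> bool" where
  "psd M \<longleftrightarrow> transpose M = M \<and> (\<forall>v. 0 \<le> v \<bullet> (M *v v))"

definition pos_def :: "real^'m^'m \<Rightarrow> bool" where
  "pos_def M \<longleftrightarrow> transpose M = M \<and> (\<forall>v. v \<noteq> 0 \<longrightarrow> 0 < v \<bullet> (M *v v))"

definition indicator_vec :: "'n set \<Rightarrow> real^'n" where
  "indicator_vec S = (\<chi> i. if i \<in> S then 1 else 0)"

text \<open>The principal submatrices of \<open>A\<close> and \<open>B\<close> indexed by \<open>S\<close> are
  two-sided inverses of each other; entries outside \<open>S \<times> S\<close> play no role.\<close>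

definition inverse_on :: "'n set \<Rightarrow> real^'n^'n \<Rightarrow> real^'n^'n \<Rightarrow> bool" where
  "inverse_on S A B \<longleftrightarrow> (\<forall>i\<in>S. \<forall>j\<in>S.
     (\<Sum>k\<in>S. A$i$k * B$k$j) = (if i = j then 1 else 0) \<and>
     (\<Sum>k\<in>S. B$i$k * A$k$j) = (if i = j then 1 else 0))"

text \<open>The inverse of the principal submatrix indexed by \<open>S\<close>, padded with zeros to
  full size. It is well defined for positive definite \<open>Q\<close>, see
  \<open>padded_inverse_ex1\<close> below.\<close>

definition padded_inverse :: "real^'n^'n \<Rightarrow> 'n set \<Rightarrow> real^'n^'n" where
  "padded_inverse Q S =
     (THE M. inverse_on S Q M \<and> (\<forall>i j. i \<notin> S \<or> j \<notin> S \<longrightarrow> M$i$j = 0))"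

text \<open>The symmetric block matrix with diagonal blocks \<open>W\<close>, \<open>t\<close> and
  off-diagonal block \<open>x\<close>; the index \<open>Inr ()\<close> is the last row and column.\<close>

definition bordered :: "real^'n^'n \<Rightarrow> real^'n \<Rightarrow> real \<Rightarrow> real^('n + unit)^('n + unit)" where
  "bordered W x t = (\<chi> i j.
     (case i of
        Inl p \<Rightarrow> (case j of Inl q \<Rightarrow> W$p$q | Inr _ \<Rightarrow> x$p)
      | Inr _ \<Rightarrow> (case j of Inl q \<Rightarrow> x$q | Inr _ \<Rightarrow> t)))"

text \<open>On \<open>real^'n\<close>, \<open>*\<close> is the entrywise (Hadamard) product and
  \<open>1\<close> is the all-ones vector.\<close>

definition mixed_epigraph :: "real^'n^'n \<Rightarrow> (real^'n) set \<Rightarrow> ((real^'n) \<times> (real^'n) \<times> real) set" where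
  "mixed_epigraph Q Z = {(x, z, t). z \<in> Z \<and> x \<bullet> (Q *v x) \<le> t \<and> x * (1 - z) = 0}"

definition inverse_polytope :: "real^'n^'n \<Rightarrow> (real^'n) set \<Rightarrow> ((real^'n) \<times> (real^'n^'n)) set" where
  "inverse_polytope Q Z =
     convex hull {(indicator_vec S, padded_inverse Q S) | S. indicator_vec S \<in> Z}"

lemma inverse_on_unique:
  fixes Q M N :: "real^'n^'n"
  assumes "inverse_on S Q M" "inverse_on S Q N" "i \<in> S" "j \<in> S"
  shows "M$i$j = N$i$j"
proof -
  have "M$i$j = (\<Sum>k\<in>S. if k = j then M$i$k else 0)"
    using assms by simp
  also have "\<dots> = (\<Sum>k\<in>S. M$i$k * (\<Sum>l\<in>S. Q$k$l * N$l$j))"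
    using assms by (intro sum.cong) (auto simp: inverse_on_def)
  also have "\<dots> = (\<Sum>l\<in>S. (\<Sum>k\<in>S. M$i$k * Q$k$l) * N$l$j)"
    by (simp add: sum_distrib_left sum_distrib_right mult.assoc) (rule sum.swap)
  also have "\<dots> = (\<Sum>l\<in>S. (if i = l then N$l$j else 0))"
    using assms by (intro sum.cong) (auto simp: inverse_on_def)
  also have "\<dots> = N$i$j"
    using assms by simp
  finally show ?thesis .
qed

lemma padded_inverse_ex1:
  fixes Q :: "real^'n^'n"
  assumes "pos_def Q"
  shows "\<exists>!M. inverse_on S Q M \<and> (\<forall>i j. i \<notin> S \<or> j \<notin> S \<longrightarrow> M$i$j = 0)"
proof (rule ex_ex1I)
  define A :: "real^'n^'n"
    where "A = (\<chi> i j. if i \<in> S \<and> j \<in> S then Q$i$j else if i = j then 1 else 0)"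
  have "v = 0" if "A *v v = 0" for v
  proof (rule ccontr)
    assume "v \<noteq> 0"
    have row: "(\<Sum>k\<in>UNIV. A$i$k * v$k) = 0" for i
      using arg_cong[OF that, of "\<lambda>w. w$i"] by (simp add: matrix_vector_mult_def)
    have off: "v$i = 0" if "i \<notin> S" for i
      using row[of i] that by (simp add: A_def if_distrib[of "\<lambda>a. a * _"] cong: if_cong)
    have "(\<Sum>k\<in>UNIV. Q$i$k * v$k) = 0" if "i \<in> S" for i
    proof -
      have "(\<Sum>k\<in>UNIV. Q$i$k * v$k) = (\<Sum>k\<in>UNIV. A$i$k * v$k)"
        using that off by (intro sum.cong) (auto simp: A_def)
      then show ?thesis using row by simp
    qed
    then have "v$i * (Q *v v)$i = 0" for i
      using off by (cases "i \<in> S") (auto simp: matrix_vector_mult_def)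
    then have "v \<bullet> (Q *v v) = 0"
      unfolding inner_vec_def by (intro sum.neutral) simp
    with \<open>v \<noteq> 0\<close> assms show False
      by (auto simp: pos_def_def)
  qed
  then have "invertible A"
    by (metis invertible_left_inverse matrix_left_invertible_ker)
  then obtain B where B: "A ** B = mat 1" "B ** A = mat 1"
    by (auto simp: invertible_def)
  define M :: "real^'n^'n" where "M = (\<chi> i j. if i \<in> S \<and> j \<in> S then B$i$j else 0)"
  have "inverse_on S Q M"
    unfolding inverse_on_def
  proof (intro ballI conjI)
    fix i j assume ij: "i \<in> S" "j \<in> S"
    have "(\<Sum>k\<in>S. Q$i$k * M$k$j) = (\<Sum>k\<in>UNIV. A$i$k * B$k$j)"
      using ij by (intro sum.mono_neutral_cong_left) (auto simp: A_def M_def)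
    also have "\<dots> = (A ** B)$i$j" by (simp add: matrix_matrix_mult_def)
    finally show "(\<Sum>k\<in>S. Q$i$k * M$k$j) = (if i = j then 1 else 0)"
      by (simp add: B mat_def)
    have "(\<Sum>k\<in>S. M$i$k * Q$k$j) = (\<Sum>k\<in>UNIV. B$i$k * A$k$j)"
      using ij by (intro sum.mono_neutral_cong_left) (auto simp: A_def M_def)
    also have "\<dots> = (B ** A)$i$j" by (simp add: matrix_matrix_mult_def)
    finally show "(\<Sum>k\<in>S. M$i$k * Q$k$j) = (if i = j then 1 else 0)"
      by (simp add: B mat_def)
  qed
  then show "\<exists>M. inverse_on S Q M \<and> (\<forall>i j. i \<notin> S \<or> j \<notin> S \<longrightarrow> M$i$j = 0)"
    by (intro exI[of _ M]) (auto simp: M_def)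
next
  fix M N
  assume "inverse_on S Q M \<and> (\<forall>i j. i \<notin> S \<or> j \<notin> S \<longrightarrow> M$i$j = 0)"
    and "inverse_on S Q N \<and> (\<forall>i j. i \<notin> S \<or> j \<notin> S \<longrightarrow> N$i$j = 0)"
  then show "M = N"
    by (metis inverse_on_unique vec_eq_iff)
qed

end

theory Submission
  imports Defs
begin

text \<open>
  Let \<open>M\<^sub>S\<close> be the zero-padded inverse of the submatrix \<open>Q\<^sub>S\<close>. Then \<open>M\<^sub>S Q x = x\<close> for every
  \<open>x\<close> supported on \<open>S\<close>, and hence \<open>M\<^sub>S Q M\<^sub>S = M\<^sub>S\<close>.

  The closed convex hull lies in the right-hand side: if \<open>x\<close> is supported on \<open>S\<close> and
  \<open>x \<bullet> Q x \<le> t\<close>, the quadratic form of the bordered matrix of \<open>M\<^sub>S\<close>, \<open>x\<close>, \<open>t\<close> at \<open>(v, s)\<close> is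
  at least \<open>y \<bullet> Q y \<ge> 0\<close> with \<open>y = M\<^sub>S v + s x\<close>, so \<open>W = M\<^sub>S\<close> is a witness. The right-hand
  side is convex, and it is closed because \<open>W\<close> ranges over a compact set
  (\<open>mixed_epigraph_subset_psd_lift\<close>, \<open>convex_psd_lift\<close>, \<open>closed_psd_lift\<close>).

  Conversely, positive semidefiniteness of the bordered matrix forces \<open>x = W u\<close> and
  \<open>u \<bullet> W u \<le> t\<close> for some \<open>u\<close> (\<open>psd_bordered_obtain\<close>). If \<open>(z, W)\<close> is the convex combination
  of the vertices \<open>(e\<^sub>S, M\<^sub>S)\<close> with weights \<open>\<lambda>\<^sub>S\<close>, then \<open>x\<close> is the combination of the vectors
  \<open>x\<^sub>S = M\<^sub>S u\<close>, which are supported on \<open>S\<close>, and the values \<open>x\<^sub>S \<bullet> Q x\<^sub>S = u \<bullet> M\<^sub>S u\<close> average to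
  \<open>u \<bullet> W u\<close>. So \<open>(x, z, t)\<close> already lies in the convex hull, without closure
  (\<open>psd_lift_subset_convex_hull\<close>).

  For the optimization problem, the bordered form at \<open>(a, 1)\<close> gives
  \<open>a \<bullet> x + t/2 \<ge> - (a \<bullet> W a)/2\<close>. The resulting lower bound \<open>b \<bullet> z - (a \<bullet> W a)/2\<close> of the
  objective is linear in \<open>(z, W)\<close>, hence minimal at a vertex \<open>(e\<^sub>S, M\<^sub>S)\<close>, where it is attained by
  \<open>x = - M\<^sub>S a\<close> and \<open>t = a \<bullet> M\<^sub>S a\<close> (\<open>integral_optimal_solution\<close>).
\<close>

section \<open>Quadratic forms of bordered matrices\<close>

lemma inner_bordered:
  fixes v :: "real^('n::finite + unit)"
  shows "v \<bullet> (bordered W x t *v v) =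
    (\<chi> i. v$Inl i) \<bullet> (W *v (\<chi> i. v$Inl i)) + 2 * v$Inr () * ((\<chi> i. v$Inl i) \<bullet> x) + (v$Inr ())\<^sup>2 * t"
proof -
  have sum_UNIV: "(\<Sum>k\<in>UNIV. f k) = (\<Sum>i\<in>UNIV. f (Inl i)) + f (Inr ())"
    for f :: "'n + unit \<Rightarrow> real"
    unfolding UNIV_Plus_UNIV[symmetric] by (subst sum.Plus) (auto simp: UNIV_unit)
  define p :: "real^'n" where "p = (\<chi> i. v$Inl i)"
  have Inl: "(bordered W x t *v v) $ Inl i = (W *v p + v$Inr () *\<^sub>R x) $ i" for i
    by (simp add: matrix_vector_mult_def sum_UNIV bordered_def p_def mult.commute)
  have Inr: "(bordered W x t *v v) $ Inr () = x \<bullet> p + t * v$Inr ()"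
    by (simp add: matrix_vector_mult_def sum_UNIV bordered_def p_def inner_vec_def)
  have "v \<bullet> (bordered W x t *v v)
      = (\<Sum>i\<in>UNIV. p$i * (W *v p + v$Inr () *\<^sub>R x) $ i) + v$Inr () * (x \<bullet> p + t * v$Inr ())"
    unfolding inner_vec_def[of v] sum_UNIV Inl Inr by (simp add: p_def)
  also have "(\<Sum>i\<in>UNIV. p$i * (W *v p + v$Inr () *\<^sub>R x) $ i) = p \<bullet> (W *v p + v$Inr () *\<^sub>R x)"
    unfolding inner_vec_def[of p] inner_real_def ..
  also have "p \<bullet> (W *v p + v$Inr () *\<^sub>R x) + v$Inr () * (x \<bullet> p + t * v$Inr ())
      = p \<bullet> (W *v p) + 2 * v$Inr () * (p \<bullet> x) + (v$Inr ())\<^sup>2 * t"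
    by (simp add: inner_add_right inner_commute[of x] power2_eq_square distrib_left)
  finally show ?thesis
    by (simp only: p_def)
qed

lemma symmetric_entries:
  fixes A :: "real^'n^'n"
  assumes "transpose A = A"
  shows "A$i$j = A$j$i"
  using arg_cong[OF assms, of "\<lambda>M. M$j$i"] by (simp add: transpose_def)

lemma psd_bordered_iff:
  "psd (bordered W x t) \<longleftrightarrow>
    transpose W = W \<and> (\<forall>v s. 0 \<le> v \<bullet> (W *v v) + 2 * s * (v \<bullet> x) + s\<^sup>2 * t)"
proof -
  have "transpose (bordered W x t) = bordered W x t \<longleftrightarrow> transpose W = W"
  proof
    assume "transpose (bordered W x t) = bordered W x t"
    then have "transpose (bordered W x t) $ Inl i $ Inl j = bordered W x t $ Inl i $ Inl j" for i j
      by simp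
    then show "transpose W = W"
      by (simp add: vec_eq_iff bordered_def transpose_def)
  next
    assume "transpose W = W"
    from symmetric_entries[OF this]
    show "transpose (bordered W x t) = bordered W x t"
      by (simp add: vec_eq_iff bordered_def transpose_def split: sum.split)
  qed
  moreover have "(\<forall>v. 0 \<le> v \<bullet> (bordered W x t *v v)) \<longleftrightarrow>
    (\<forall>v s. 0 \<le> v \<bullet> (W *v v) + 2 * s * (v \<bullet> x) + s\<^sup>2 * t)"
  proof (intro iffI allI)
    fix v s
    assume nonneg: "\<forall>v. 0 \<le> v \<bullet> (bordered W x t *v v)"
    define y :: "real^('a + unit)" where "y = (\<chi> k. case k of Inl i \<Rightarrow> v$i | Inr _ \<Rightarrow> s)"
    have "(\<chi> i. y$Inl i) = v" "y$Inr () = s"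
      by (simp_all add: y_def)
    then show "0 \<le> v \<bullet> (W *v v) + 2 * s * (v \<bullet> x) + s\<^sup>2 * t"
      using spec[OF nonneg, of y] by (simp only: inner_bordered)
  qed (simp add: inner_bordered)
  ultimately show ?thesis
    by (simp add: psd_def)
qed

lemma symmetric_inner_mult:
  fixes A :: "real^'n^'n"
  assumes "transpose A = A"
  shows "u \<bullet> (A *v v) = (A *v u) \<bullet> v"
  by (metis assms dot_lmul_matrix vector_transpose_matrix)

section \<open>Padded inverses of principal submatrices\<close>

lemma padded_inverse:
  assumes "pos_def Q"
  shows "inverse_on S Q (padded_inverse Q S)"
    and "i \<notin> S \<or> j \<notin> S \<Longrightarrow> padded_inverse Q S $ i $ j = 0"
  using theI'[OF padded_inverse_ex1[OF assms, of S], folded padded_inverse_def] by blast+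

lemma transpose_padded_inverse:
  fixes Q :: "real^'n^'n"
  assumes "pos_def Q"
  shows "transpose (padded_inverse Q S) = padded_inverse Q S"
proof -
  let ?M = "padded_inverse Q S"
  have sym: "Q$i$j = Q$j$i" for i j
    using assms by (intro symmetric_entries) (simp add: pos_def_def)
  have "inverse_on S Q (transpose ?M)"
    unfolding inverse_on_def
  proof (intro ballI)
    fix i j assume ij: "i \<in> S" "j \<in> S"
    have "(\<Sum>k\<in>S. ?M$j$k * Q$k$i) = (if j = i then 1 else 0)"
      "(\<Sum>k\<in>S. Q$j$k * ?M$k$i) = (if j = i then 1 else 0)"
      using padded_inverse(1)[OF assms, of S] ij unfolding inverse_on_def by blast+
    moreover have "(\<Sum>k\<in>S. Q$i$k * transpose ?M$k$j) = (\<Sum>k\<in>S. ?M$j$k * Q$k$i)"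
      by (rule sum.cong) (simp_all add: transpose_def sym[of i] mult.commute)
    moreover have "(\<Sum>k\<in>S. transpose ?M$i$k * Q$k$j) = (\<Sum>k\<in>S. Q$j$k * ?M$k$i)"
      by (rule sum.cong) (simp_all add: transpose_def sym[of j] mult.commute)
    ultimately show "(\<Sum>k\<in>S. Q$i$k * transpose ?M$k$j) = (if i = j then 1 else 0) \<and>
        (\<Sum>k\<in>S. transpose ?M$i$k * Q$k$j) = (if i = j then 1 else 0)"
      by auto
  qed
  from inverse_on_unique[OF this padded_inverse(1)[OF assms, of S]]
  have "transpose ?M $ i $ j = ?M $ i $ j" for i j
    by (cases "i \<in> S \<and> j \<in> S") (auto simp: transpose_def padded_inverse(2)[OF assms])
  then show ?thesis
    by (simp add: vec_eq_iff)
qed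

lemma padded_inverse_mult_outside:
  assumes "pos_def Q" "i \<notin> S"
  shows "(padded_inverse Q S *v u) $ i = 0"
  by (simp add: matrix_vector_mult_def padded_inverse(2)[OF assms(1)] assms(2))

lemma padded_inverse_left_inverse:
  fixes Q :: "real^'n^'n"
  assumes "pos_def Q" and supp: "\<And>i. i \<notin> S \<Longrightarrow> x$i = 0"
  shows "padded_inverse Q S *v (Q *v x) = x"
proof (subst vec_eq_iff, rule allI)
  fix i
  let ?M = "padded_inverse Q S"
  show "(?M *v (Q *v x))$i = x$i"
  proof (cases "i \<in> S")
    case True
    have "(?M *v (Q *v x))$i = (\<Sum>k\<in>S. ?M$i$k * (\<Sum>l\<in>S. Q$k$l * x$l))"
      unfolding matrix_vector_mult_def vec_lambda_beta
      by (rule sum.mono_neutral_cong_right)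
        (auto simp: padded_inverse(2)[OF assms(1)] supp
           intro!: arg_cong[of _ _ "(*) _"] sum.mono_neutral_right)
    also have "\<dots> = (\<Sum>l\<in>S. (\<Sum>k\<in>S. ?M$i$k * Q$k$l) * x$l)"
      by (simp add: sum_distrib_left sum_distrib_right mult.assoc) (rule sum.swap)
    also have "\<dots> = (\<Sum>l\<in>S. if i = l then x$l else 0)"
      using True padded_inverse(1)[OF assms(1), of S]
      by (intro sum.cong) (auto simp: inverse_on_def)
    finally show ?thesis using True by simp
  qed (simp add: padded_inverse_mult_outside[OF assms(1)] supp)
qed

text \<open>The identity \<open>M Q M = M\<close> for \<open>M = padded_inverse Q S\<close>, read as an equality of quadratic
  forms.\<close>

lemma inner_padded_inverse:
  assumes "pos_def Q"
  shows "(padded_inverse Q S *v u) \<bullet> (Q *v (padded_inverse Q S *v u))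
    = u \<bullet> (padded_inverse Q S *v u)"
  by (metis assms padded_inverse_left_inverse padded_inverse_mult_outside
      symmetric_inner_mult transpose_padded_inverse)

lemma pos_def_nonneg:
  assumes "pos_def Q"
  shows "0 \<le> v \<bullet> (Q *v v)"
  using assms by (cases "v = 0") (auto simp: pos_def_def less_imp_le)

lemma psd_bordered_padded_inverse:
  fixes Q :: "real^'n^'n"
  assumes "pos_def Q" and supp: "\<And>i. i \<notin> S \<Longrightarrow> x$i = 0" and t: "x \<bullet> (Q *v x) \<le> t"
  shows "psd (bordered (padded_inverse Q S) x t)"
  unfolding psd_bordered_iff
proof (intro conjI allI)
  let ?M = "padded_inverse Q S"
  show "transpose ?M = ?M"
    by (rule transpose_padded_inverse[OF assms(1)])
  fix v s
  define y where "y = ?M *v v + s *\<^sub>R x"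
  have symQ: "transpose Q = Q"
    using assms(1) by (simp add: pos_def_def)
  have "(?M *v v) \<bullet> (Q *v x) = v \<bullet> x"
    by (metis assms(1) padded_inverse_left_inverse supp symmetric_inner_mult transpose_padded_inverse)
  moreover from this have "x \<bullet> (Q *v (?M *v v)) = v \<bullet> x"
    by (metis inner_commute symQ symmetric_inner_mult)
  ultimately have "y \<bullet> (Q *v y) = v \<bullet> (?M *v v) + 2 * s * (v \<bullet> x) + s\<^sup>2 * (x \<bullet> (Q *v x))"
    by (simp add: y_def matrix_vector_right_distrib matrix_vector_mult_scaleR inner_add_left
        inner_add_right inner_padded_inverse[OF assms(1)] power2_eq_square algebra_simps)
  also have "\<dots> \<le> v \<bullet> (?M *v v) + 2 * s * (v \<bullet> x) + s\<^sup>2 * t"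
    by (simp add: t mult_left_mono)
  finally show "0 \<le> v \<bullet> (?M *v v) + 2 * s * (v \<bullet> x) + s\<^sup>2 * t"
    using pos_def_nonneg[OF assms(1), of y] by linarith
qed

text \<open>Range condition and Schur complement bound for a positive semidefinite bordered matrix,
  stated without a pseudo-inverse of \<open>W\<close>.\<close>

lemma psd_bordered_obtain:
  fixes W :: "real^'n^'n"
  assumes "psd (bordered W x t)"
  obtains u where "x = W *v u" "u \<bullet> (W *v u) \<le> t"
proof -
  have sym: "transpose W = W"
    and nonneg: "\<And>v s. 0 \<le> v \<bullet> (W *v v) + 2 * s * (v \<bullet> x) + s\<^sup>2 * t"
    using assms by (auto simp: psd_bordered_iff)
  obtain y w where y: "y \<in> span (range ((*v) W))"
    and w: "\<And>r. r \<in> span (range ((*v) W)) \<Longrightarrow> orthogonal w r" and x: "x = y + w"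
    using orthogonal_subspace_decomp_exists[of "range ((*v) W)" x] by metis
  have "w \<bullet> (W *v (W *v w)) = 0"
    using w[of "W *v (W *v w)"] by (simp add: orthogonal_def span_base)
  then have "W *v w = 0"
    by (simp add: symmetric_inner_mult[OF sym, of w])
  have wx: "w \<bullet> x = w \<bullet> w"
    using w[OF y] by (simp add: x inner_add_right orthogonal_def)
  have quad: "0 \<le> 2 * s * (w \<bullet> w) + s\<^sup>2 * t" for s
    using nonneg[of w s] \<open>W *v w = 0\<close> wx by simp
  \<comment> \<open>The nonnegative quadratic \<open>2 (w \<bullet> w) s + t s\<^sup>2\<close> vanishes at \<open>s = 0\<close>, so its slope there is zero;
    the witness below is a negative \<open>s\<close> so small that the linear term dominates.\<close>
  have "w \<bullet> w = 0"
  proof (rule ccontr)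
    assume "w \<bullet> w \<noteq> 0"
    define s where "s = - (w \<bullet> w) / (\<bar>t\<bar> + 1)"
    have pos: "0 < w \<bullet> w" using \<open>w \<bullet> w \<noteq> 0\<close> by (simp add: order_less_le)
    have "s < 0" using pos by (simp add: s_def add_nonneg_pos)
    have "s * (2 * (w \<bullet> w) + s * t) \<ge> 0"
      using quad[of s] by (simp add: power2_eq_square algebra_simps)
    then have "2 * (w \<bullet> w) + s * t \<le> 0"
      using \<open>s < 0\<close> by (simp add: zero_le_mult_iff)
    moreover have "- s * t \<le> (w \<bullet> w) * 1"
    proof -
      have "- s * t = (w \<bullet> w) * (t / (\<bar>t\<bar> + 1))" by (simp add: s_def)
      also have "\<dots> \<le> (w \<bullet> w) * 1"
        using pos by (intro mult_left_mono) (auto simp: divide_simps)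
      finally show ?thesis .
    qed
    ultimately show False using pos by simp
  qed
  then have "x = y" by (simp add: x)
  moreover have "subspace (range ((*v) W))"
    by (intro linear_subspace_image subspace_UNIV) (simp add: matrix_vector_mul_linear)
  ultimately obtain u where u: "x = W *v u"
    using y by (metis imageE span_eq_iff)
  have "u \<bullet> (W *v u) \<le> t"
    using nonneg[of u "-1"] by (simp add: u)
  with u show ?thesis by (rule that)
qed

section \<open>The semidefinite description of the closed convex hull\<close>

text \<open>The projection to \<open>(x, z, t)\<close> of the feasible set of the semidefinite formulation.\<close>

definition psd_lift :: "real^'n^'n \<Rightarrow> (real^'n) set \<Rightarrow> ((real^'n) \<times> (real^'n) \<times> real) set" where
  "psd_lift Q Z = {(x, z, t). (\<forall>i. z$i \<in> {0..1}) \<and>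
     (\<exists>W. psd (bordered W x t) \<and> (z, W) \<in> inverse_polytope Q Z)}"

lemma mixed_epigraph_subset_psd_lift:
  fixes Q :: "real^'n^'n"
  assumes "pos_def Q" "Z \<subseteq> {z. \<forall>i. z$i \<in> {0, 1}}"
  shows "mixed_epigraph Q Z \<subseteq> psd_lift Q Z"
proof clarify
  fix x z t
  assume "(x, z, t) \<in> mixed_epigraph Q Z"
  then have z: "z \<in> Z" and t: "x \<bullet> (Q *v x) \<le> t" and compl: "x * (1 - z) = 0"
    by (auto simp: mixed_epigraph_def)
  define S where "S = {i. z$i = 1}"
  have z01: "z$i = 0 \<or> z$i = 1" for i
    using z assms(2) by auto
  have zS: "z = indicator_vec S"
    using z01 by (auto simp: S_def indicator_vec_def vec_eq_iff)
  have "x$i = 0" if "i \<notin> S" for i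
    using arg_cong[OF compl, of "\<lambda>y. y$i"] that z01[of i] by (simp add: S_def)
  then have "psd (bordered (padded_inverse Q S) x t)"
    by (intro psd_bordered_padded_inverse assms t)
  moreover have "(z, padded_inverse Q S) \<in> inverse_polytope Q Z"
    unfolding inverse_polytope_def using z zS by (intro hull_inc) auto
  moreover have "z$i \<in> {0..1}" for i
    using z01[of i] by auto
  ultimately show "(x, z, t) \<in> psd_lift Q Z"
    by (auto simp: psd_lift_def)
qed

lemma transpose_add: "transpose (A + B) = transpose A + transpose B"
  by (simp add: transpose_def vec_eq_iff)

lemma convex_psd_lift: "convex (psd_lift Q Z)"
proof (rule convexI)
  fix p q :: "(real^'a) \<times> (real^'a) \<times> real" and \<alpha> \<beta> :: real
  assume "p \<in> psd_lift Q Z" "q \<in> psd_lift Q Z" and lm: "0 \<le> \<alpha>" "0 \<le> \<beta>" "\<alpha> + \<beta> = 1"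
  then obtain x z t W x' z' t' W' where p: "p = (x, z, t)" "psd (bordered W x t)"
      "(z, W) \<in> inverse_polytope Q Z" "\<And>i. 0 \<le> z$i" "\<And>i. z$i \<le> 1"
    and q: "q = (x', z', t')" "psd (bordered W' x' t')"
      "(z', W') \<in> inverse_polytope Q Z" "\<And>i. 0 \<le> z'$i" "\<And>i. z'$i \<le> 1"
    by (auto simp: psd_lift_def)
  have "\<alpha> *\<^sub>R (z, W) + \<beta> *\<^sub>R (z', W') \<in> inverse_polytope Q Z"
    using p q lm unfolding inverse_polytope_def by (intro convexD convex_convex_hull) auto
  moreover have "psd (bordered (\<alpha> *\<^sub>R W + \<beta> *\<^sub>R W') (\<alpha> *\<^sub>R x + \<beta> *\<^sub>R x') (\<alpha> * t + \<beta> * t'))"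
    unfolding psd_bordered_iff
  proof (intro conjI allI)
    show "transpose (\<alpha> *\<^sub>R W + \<beta> *\<^sub>R W') = \<alpha> *\<^sub>R W + \<beta> *\<^sub>R W'"
      using p(2) q(2) by (simp add: psd_bordered_iff transpose_add transpose_scalar)
    fix v s
    have "0 \<le> \<alpha> * (v \<bullet> (W *v v) + 2 * s * (v \<bullet> x) + s\<^sup>2 * t)
       + \<beta> * (v \<bullet> (W' *v v) + 2 * s * (v \<bullet> x') + s\<^sup>2 * t')"
      using p(2) q(2) lm by (simp add: psd_bordered_iff)
    also have "\<dots> = v \<bullet> ((\<alpha> *\<^sub>R W + \<beta> *\<^sub>R W') *v v) + 2 * s * (v \<bullet> (\<alpha> *\<^sub>R x + \<beta> *\<^sub>R x'))
       + s\<^sup>2 * (\<alpha> * t + \<beta> * t')"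
      by (simp add: matrix_vector_mult_add_rdistrib scaleR_matrix_vector_assoc[symmetric]
          inner_add_right algebra_simps)
    finally show "0 \<le> \<dots>" .
  qed
  moreover have "0 \<le> \<alpha> * z$i + \<beta> * z'$i" "\<alpha> * z$i + \<beta> * z'$i \<le> 1" for i
    using p q lm convex_bound_le[of "z$i" 1 "z'$i" \<alpha> \<beta>] by auto
  ultimately show "\<alpha> *\<^sub>R p + \<beta> *\<^sub>R q \<in> psd_lift Q Z"
    by (auto simp: psd_lift_def p q)
qed

lemma compact_inverse_polytope: "compact (inverse_polytope Q Z)"
  unfolding inverse_polytope_def
  by (intro finite_imp_compact_convex_hull finite_Collect_conjI)
    (auto simp: setcompr_eq_image)

lemma closed_psd_lift: "closed (psd_lift (Q :: real^'n^'n) Z)"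
proof -
  let ?P = "inverse_polytope Q Z"
  let ?T = "{(W :: real^'n^'n, p :: (real^'n) \<times> (real^'n) \<times> real).
    (\<forall>i. 0 \<le> fst (snd p) $ i \<and> fst (snd p) $ i \<le> 1) \<and> transpose W = W \<and>
    (\<forall>v s. 0 \<le> v \<bullet> (W *v v) + 2 * s * (v \<bullet> fst p) + s\<^sup>2 * snd (snd p)) \<and>
    (fst (snd p), W) \<in> ?P}"
  have [continuous_intros]: "continuous_on A (\<lambda>p. f p *v v)" if "continuous_on A f"
    for A :: "((real^'n^'n) \<times> (real^'n) \<times> (real^'n) \<times> real) set"
      and f :: "_ \<Rightarrow> real^'n^'n" and v
    unfolding matrix_vector_mult_def using that by (intro continuous_intros)
  have [continuous_intros]: "continuous_on A (\<lambda>p. transpose (f p))" if "continuous_on A f"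
    for A :: "((real^'n^'n) \<times> (real^'n) \<times> (real^'n) \<times> real) set"
      and f :: "_ \<Rightarrow> real^'n^'n"
    unfolding transpose_def using that by (intro continuous_intros)
  have "closed {p :: (real^'n^'n) \<times> (real^'n) \<times> (real^'n) \<times> real. (fst (snd (snd p)), fst p) \<in> ?P}"
    using closed_vimage[OF compact_imp_closed[OF compact_inverse_polytope],
        of "\<lambda>p :: (real^'n^'n) \<times> (real^'n) \<times> (real^'n) \<times> real. (fst (snd (snd p)), fst p)" Q Z]
    by (simp add: vimage_def continuous_on_Pair continuous_on_fst continuous_on_snd continuous_on_id)
  then have "closed ?T"
    unfolding case_prod_unfold
    by (intro closed_Collect_conj closed_Collect_all closed_Collect_le closed_Collect_eq
        continuous_intros)
  moreover have "compact (snd ` ?P)"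
    by (intro compact_continuous_image compact_inverse_polytope continuous_intros)
  ultimately have "closed {p. \<exists>W. W \<in> snd ` ?P \<and> (W, p) \<in> ?T}"
    by (intro closed_compact_projection)
  also have "{p. \<exists>W. W \<in> snd ` ?P \<and> (W, p) \<in> ?T} = psd_lift Q Z"
  proof -
    have "snd ` ?P = {W. \<exists>z. (z, W) \<in> ?P}"
      by force
    then show ?thesis
      unfolding psd_lift_def psd_bordered_iff by auto
  qed
  finally show ?thesis .
qed

text \<open>A linear map sends the polytope into any convex set that contains the images of its
  generators.\<close>

lemma linear_image_inverse_polytope:
  assumes "(z, W) \<in> inverse_polytope Q Z" "linear f" "convex C"
    and vertices: "\<And>S. indicator_vec S \<in> Z \<Longrightarrow> f (indicator_vec S, padded_inverse Q S) \<in> C"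
  shows "f (z, W) \<in> C"
proof -
  have "f ` inverse_polytope Q Z \<subseteq> C"
    unfolding inverse_polytope_def convex_hull_linear_image[OF assms(2)]
    by (rule hull_minimal) (use vertices assms(3) in auto)
  with assms(1) show ?thesis by auto
qed

text \<open>Applying \<open>W\<close> to a fixed \<open>u\<close> splits the point along the generators
  \<open>(indicator_vec S, padded_inverse Q S)\<close> of the polytope; \<open>d\<close> is the slack in the epigraph
  inequality.\<close>

lemma split_along_polytope:
  fixes Q :: "real^'n^'n"
  assumes "pos_def Q" "(z, W) \<in> inverse_polytope Q Z" "0 \<le> d"
  shows "(W *v u, z, u \<bullet> (W *v u) + d) \<in> convex hull mixed_epigraph Q Z"
proof -
  define f :: "(real^'n) \<times> (real^'n^'n) \<Rightarrow> (real^'n) \<times> (real^'n) \<times> real"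
    where "f p = (snd p *v u, fst p, u \<bullet> (snd p *v u))" for p
  have "linear f"
    by (rule linearI) (simp_all add: f_def matrix_vector_mult_add_rdistrib inner_add_right
        scaleR_matrix_vector_assoc[symmetric])
  moreover have "convex ((+) (0, 0, - d) ` (convex hull mixed_epigraph Q Z))"
    by (intro convex_translation convex_convex_hull)
  moreover have "f (indicator_vec S, padded_inverse Q S)
      \<in> (+) (0, 0, - d) ` (convex hull mixed_epigraph Q Z)"
    if "indicator_vec S \<in> Z" for S
  proof -
    let ?x = "padded_inverse Q S *v u"
    have "?x * (1 - indicator_vec S) = 0"
      by (simp add: vec_eq_iff indicator_vec_def padded_inverse_mult_outside[OF assms(1)])
    then have "(?x, indicator_vec S, u \<bullet> ?x + d) \<in> convex hull mixed_epigraph Q Z"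
      using that assms(3)
      by (intro hull_inc) (simp add: mixed_epigraph_def inner_padded_inverse[OF assms(1)])
    then show ?thesis
      by (rule rev_image_eqI) (simp add: f_def)
  qed
  ultimately have "f (z, W) \<in> (+) (0, 0, - d) ` (convex hull mixed_epigraph Q Z)"
    by (rule linear_image_inverse_polytope[OF assms(2)])
  then show ?thesis
    by (auto simp: f_def)
qed

lemma psd_lift_subset_convex_hull:
  assumes "pos_def Q"
  shows "psd_lift Q Z \<subseteq> convex hull mixed_epigraph Q Z"
proof clarify
  fix x z t
  assume "(x, z, t) \<in> psd_lift Q Z"
  then obtain W where W: "psd (bordered W x t)" "(z, W) \<in> inverse_polytope Q Z"
    by (auto simp: psd_lift_def)
  from W(1) obtain u where "x = W *v u" "u \<bullet> (W *v u) \<le> t"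
    by (rule psd_bordered_obtain)
  then show "(x, z, t) \<in> convex hull mixed_epigraph Q Z"
    using split_along_polytope[OF assms W(2), of "t - u \<bullet> (W *v u)" u] by simp
qed

section \<open>Integral optimal solutions\<close>

lemma integral_optimal_solution:
  fixes Q :: "real^'n^'n"
  assumes "pos_def Q" "indicator_vec S\<^sub>0 \<in> Z"
  shows "\<exists>x S W t. is_arg_min (\<lambda>(x, z, W, t). a \<bullet> x + b \<bullet> z + 1/2 * t)
    (\<lambda>(x, z, W, t). psd (bordered W x t) \<and> (z, W) \<in> inverse_polytope Q Z)
    (x, indicator_vec S, W, t)"
proof -
  \<comment> \<open>\<open>val S\<close> is the minimum of the objective for \<open>z = indicator_vec S\<close> and
    \<open>W = padded_inverse Q S\<close>.\<close>
  define val where "val S = b \<bullet> indicator_vec S - 1/2 * (a \<bullet> (padded_inverse Q S *v a))" for S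
  have "finite {S. indicator_vec S \<in> Z}" "{S. indicator_vec S \<in> Z} \<noteq> {}"
    using assms(2) by auto
  from ex_is_arg_min_if_finite[OF this, of val]
  obtain S where S: "indicator_vec S \<in> Z"
    and min: "\<And>T. indicator_vec T \<in> Z \<Longrightarrow> val S \<le> val T"
    by (auto simp: is_arg_min_linorder)
  let ?M = "padded_inverse Q S"
  have "A *v (- v) = - (A *v v)" for A :: "real^'n^'n" and v
    by (metis matrix_vector_mult_scaleR scaleR_minus1_left)
  then have feasible: "psd (bordered ?M (- (?M *v a)) (a \<bullet> (?M *v a)))"
    using psd_bordered_padded_inverse[OF assms(1), of S "?M *v (- a)" "a \<bullet> (?M *v a)"]
    by (simp add: padded_inverse_mult_outside[OF assms(1)] inner_padded_inverse[OF assms(1)])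
  have bound: "val S \<le> a \<bullet> x + b \<bullet> z + 1/2 * t"
    if "psd (bordered W x t)" "(z, W) \<in> inverse_polytope Q Z" for x z W t
  proof -
    define f where "f p = b \<bullet> fst p - 1/2 * (a \<bullet> (snd p *v a))"
      for p :: "(real^'n) \<times> (real^'n^'n)"
    have "linear f"
      by (rule linearI) (simp_all add: f_def matrix_vector_mult_add_rdistrib inner_add_right
          scaleR_matrix_vector_assoc[symmetric] algebra_simps add_divide_distrib)
    then have "f (z, W) \<in> {val S..}"
      by (rule linear_image_inverse_polytope[OF that(2)]) (use min in \<open>auto simp: f_def val_def\<close>)
    \<comment> \<open>The bordered form at \<open>(a, 1)\<close>.\<close>
    moreover have "0 \<le> a \<bullet> (W *v a) + 2 * 1 * (a \<bullet> x) + 1\<^sup>2 * t"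
      using that(1) unfolding psd_bordered_iff by blast
    ultimately show ?thesis
      by (simp add: f_def)
  qed
  have vertex: "(indicator_vec S, ?M) \<in> inverse_polytope Q Z"
    unfolding inverse_polytope_def using S by (intro hull_inc) auto
  have "val S = a \<bullet> (- (?M *v a)) + b \<bullet> indicator_vec S + 1/2 * (a \<bullet> (?M *v a))"
    by (simp add: val_def)
  with feasible vertex bound
  have "is_arg_min (\<lambda>(x, z, W, t). a \<bullet> x + b \<bullet> z + 1/2 * t)
    (\<lambda>(x, z, W, t). psd (bordered W x t) \<and> (z, W) \<in> inverse_polytope Q Z)
    (- (?M *v a), indicator_vec S, ?M, a \<bullet> (?M *v a))"
    unfolding is_arg_min_linorder by (simp only: split_paired_all split_paired_All split) blast
  then show ?thesis by blast
qed

theorem theorem1: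
  fixes Q :: "real^'n^'n" and Z :: "(real^'n) set"
  assumes "pos_def Q"
    and "Z \<subseteq> {z. \<forall>i. z$i \<in> {0, 1}}"
  shows "closure (convex hull (mixed_epigraph Q Z)) =
      {(x, z, t). (\<forall>i. z$i \<in> {0..1}) \<and>
         (\<exists>W. psd (bordered W x t) \<and> (z, W) \<in> inverse_polytope Q Z)} \<and>
    (Z \<noteq> {} \<longrightarrow>
      (\<forall>a b :: real^'n. \<exists>x z W t.
        is_arg_min (\<lambda>(x, z, W, t). a \<bullet> x + b \<bullet> z + 1/2 * t)
          (\<lambda>(x, z, W, t). psd (bordered W x t) \<and> (z, W) \<in> inverse_polytope Q Z)
          (x, z, W, t) \<and>
        (\<forall>i. z$i \<in> \<int>)))"
proof (intro conjI impI allI)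
  have "closure (convex hull (mixed_epigraph Q Z)) = psd_lift Q Z"
  proof (rule antisym)
    show "closure (convex hull (mixed_epigraph Q Z)) \<subseteq> psd_lift Q Z"
      by (intro closure_minimal hull_minimal mixed_epigraph_subset_psd_lift assms
          convex_psd_lift closed_psd_lift)
    show "psd_lift Q Z \<subseteq> closure (convex hull (mixed_epigraph Q Z))"
      using psd_lift_subset_convex_hull[OF assms(1)] closure_subset by (rule order_trans)
  qed
  then show "closure (convex hull (mixed_epigraph Q Z)) =
      {(x, z, t). (\<forall>i. z$i \<in> {0..1}) \<and>
         (\<exists>W. psd (bordered W x t) \<and> (z, W) \<in> inverse_polytope Q Z)}"
    by (simp add: psd_lift_def)
next
  fix a b :: "real^'n"
  assume "Z \<noteq> {}"
  then obtain z where z: "z \<in> Z" by blast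
  then have "z = indicator_vec {i. z$i = 1}"
    using assms(2) by (auto simp: indicator_vec_def vec_eq_iff)
  with z have "indicator_vec {i. z$i = 1} \<in> Z" by simp
  from integral_optimal_solution[OF assms(1) this, of a b]
  obtain x S W t where "is_arg_min (\<lambda>(x, z, W, t). a \<bullet> x + b \<bullet> z + 1/2 * t)
      (\<lambda>(x, z, W, t). psd (bordered W x t) \<and> (z, W) \<in> inverse_polytope Q Z)
      (x, indicator_vec S, W, t)"
    by blast
  moreover have "\<forall>i. (indicator_vec S :: real^'n) $ i \<in> \<int>"
    by (simp add: indicator_vec_def)
  ultimately show "\<exists>x z W t. is_arg_min (\<lambda>(x, z, W, t). a \<bullet> x + b \<bullet> z + 1/2 * t)
          (\<lambda>(x, z, W, t). psd (bordered W x t) \<and> (z, W) \<in> inverse_polytope Q Z)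
          (x, z, W, t) \<and> (\<forall>i. z$i \<in> \<int>)"
    by blast
qed

end
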